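(* Let $n\geq 1$ and let $\mathbb{Z}_2$ act on $S^n\subset\mathbb{R}^{n+1}$ by the antipodal involution, with orbit space $P^n=S^n/\mathbb{Z}_2$ (real projective space). Then there is an effectual motion planner on $S^n$ with $n+2$ domains; and if $n\in\{1,3,7\}$, there is an effectual motion planner on $S^n$ with $n+1$ domains.
   Context: $PS^n$ is the space of free paths $[0,1]\to S^n$, and $\epsilon\colon PS^n\to S^n\times P^n$ is the map $\epsilon(\gamma)=(\gamma(0),[\gamma(1)])$, where $[\,\cdot\,]$ denotes the class in $P^n$. An effectual motion planner on $S^n$ is a partition of $S^n\times P^n$ by subsets $D_i$ (the effectual domains, not required to be open) together with a family of continuous maps $s_i\colon D_i\to PS^n$ (the effectual instructions) such that $\epsilon\circ s_i$ is the inclusion $D_i\hookrightarrow S^n\times P^n$ for each $i$. *)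

theory Defs
  imports "HOL-Analysis.Analysis"
begin

text \<open>The sphere \<open>S\<^sup>n\<close> is the library's \<^const>\<open>nsphere\<close>, whose points are the unit vectors among the
  real sequences supported in the coordinates \<open>0, \<dots>, n\<close>.\<close>

definition antipode :: "(nat \<Rightarrow> real) \<Rightarrow> (nat \<Rightarrow> real)" where
  "antipode x = (\<lambda>i. - x i)"

definition antipodal_orbit :: "(nat \<Rightarrow> real) \<Rightarrow> (nat \<Rightarrow> real) set" where
  "antipodal_orbit x = {x, antipode x}"

text \<open>The quotient topology induced on the image of \<open>f\<close>.\<close>

definition quotient_topology :: "'a topology \<Rightarrow> ('a \<Rightarrow> 'b) \<Rightarrow> 'b topology" where
  "quotient_topology X f =
     topology (\<lambda>U. U \<subseteq> f ` topspace X \<and> openin X {x \<in> topspace X. f x \<in> U})"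

lemma openin_quotient_topology:
  "openin (quotient_topology X f) U \<longleftrightarrow>
     U \<subseteq> f ` topspace X \<and> openin X {x \<in> topspace X. f x \<in> U}"
proof -
  have "istopology (\<lambda>U. U \<subseteq> f ` topspace X \<and> openin X {x \<in> topspace X. f x \<in> U})"
    unfolding istopology_def
  proof (intro conjI allI impI)
    fix S T
    assume S: "S \<subseteq> f ` topspace X \<and> openin X {x \<in> topspace X. f x \<in> S}"
      and T: "T \<subseteq> f ` topspace X \<and> openin X {x \<in> topspace X. f x \<in> T}"
    show "S \<inter> T \<subseteq> f ` topspace X" using S by blast
    have "{x \<in> topspace X. f x \<in> S \<inter> T} =
        {x \<in> topspace X. f x \<in> S} \<inter> {x \<in> topspace X. f x \<in> T}" by blast
    then show "openin X {x \<in> topspace X. f x \<in> S \<inter> T}"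
      using S T by (simp only: openin_Int)
  next
    fix K
    assume K: "\<forall>S\<in>K. S \<subseteq> f ` topspace X \<and> openin X {x \<in> topspace X. f x \<in> S}"
    show "\<Union>K \<subseteq> f ` topspace X" using K by blast
    have eq: "{x \<in> topspace X. f x \<in> \<Union>K} = (\<Union>S\<in>K. {x \<in> topspace X. f x \<in> S})" by blast
    show "openin X {x \<in> topspace X. f x \<in> \<Union>K}"
      unfolding eq using K by (intro openin_Union) blast
  qed
  from topology_inverse'[OF this] show ?thesis
    unfolding quotient_topology_def by simp
qed

lemma topspace_quotient_topology: "topspace (quotient_topology X f) = f ` topspace X"
proof
  show "topspace (quotient_topology X f) \<subseteq> f ` topspace X"
    using openin_topspace[of "quotient_topology X f"] unfolding openin_quotient_topology by blast
  have "{x \<in> topspace X. f x \<in> f ` topspace X} = topspace X" by blast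
  then have "openin (quotient_topology X f) (f ` topspace X)"
    by (simp add: openin_quotient_topology)
  then show "f ` topspace X \<subseteq> topspace (quotient_topology X f)"
    by (rule openin_subset)
qed

lemma quotient_map_quotient_topology: "quotient_map X (quotient_topology X f) f"
  by (simp add: quotient_map_def topspace_quotient_topology openin_quotient_topology)

definition projective_space :: "nat \<Rightarrow> (nat \<Rightarrow> real) set topology" where
  "projective_space n = quotient_topology (nsphere n) antipodal_orbit"

text \<open>The compact-open topology on the continuous maps from \<open>X\<close> to \<open>Y\<close>. A continuous map is
  represented by its extension that is \<^const>\<open>undefined\<close> outside \<open>X\<close>.\<close>

definition compact_open_topology :: "'a topology \<Rightarrow> 'b topology \<Rightarrow> ('a \<Rightarrow> 'b) topology" where
  "compact_open_topology X Y =
     topology_generated_by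
       {{f \<in> extensional (topspace X). continuous_map X Y f \<and> f ` K \<subseteq> U} | K U.
          compactin X K \<and> openin Y U}"

lemma topspace_compact_open_topology:
  "topspace (compact_open_topology X Y) = {f \<in> extensional (topspace X). continuous_map X Y f}"
proof
  show "topspace (compact_open_topology X Y)
      \<subseteq> {f \<in> extensional (topspace X). continuous_map X Y f}"
    unfolding compact_open_topology_def topology_generated_by_topspace by blast
  have "openin (compact_open_topology X Y)
      {f \<in> extensional (topspace X). continuous_map X Y f \<and> f ` {} \<subseteq> {}}"
    unfolding compact_open_topology_def
    by (rule topology_generated_by_Basis, rule CollectI, intro exI conjI)
      (rule refl compactin_empty openin_empty)+
  then show "{f \<in> extensional (topspace X). continuous_map X Y f}
      \<subseteq> topspace (compact_open_topology X Y)"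
    using openin_subset by fastforce
qed

definition free_path_space :: "'a topology \<Rightarrow> (real \<Rightarrow> 'a) topology" where
  "free_path_space X = compact_open_topology (top_of_set {0..1}) X"

definition effectual_endpoints ::
    "(real \<Rightarrow> nat \<Rightarrow> real) \<Rightarrow> (nat \<Rightarrow> real) \<times> (nat \<Rightarrow> real) set" where
  "effectual_endpoints \<gamma> = (\<gamma> 0, antipodal_orbit (\<gamma> 1))"

text \<open>The family of instructions is indexed by the domains themselves, which loses nothing since
  the blocks of a partition are pairwise distinct.\<close>

definition effectual_motion_planner ::
    "nat \<Rightarrow> ((nat \<Rightarrow> real) \<times> (nat \<Rightarrow> real) set) set set
     \<Rightarrow> (((nat \<Rightarrow> real) \<times> (nat \<Rightarrow> real) set) set
         \<Rightarrow> (nat \<Rightarrow> real) \<times> (nat \<Rightarrow> real) set \<Rightarrow> real \<Rightarrow> nat \<Rightarrow> real)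
     \<Rightarrow> bool" where
  "effectual_motion_planner n P s \<longleftrightarrow>
     partition_on (topspace (prod_topology (nsphere n) (projective_space n))) P \<and>
     (\<forall>D\<in>P.
        continuous_map (subtopology (prod_topology (nsphere n) (projective_space n)) D)
          (free_path_space (nsphere n)) (s D) \<and>
        (\<forall>p\<in>D. effectual_endpoints (s D p) = p))"

end

(* Let c_0(x,y) = <x,y>, and let c_1, ..., c_m be continuous real functions of (x,y) on the product of
   two spheres, odd in y, such that c_0, ..., c_m have no common zero. Sort the pairs (x,[y]) by the
   index k of the first nonvanishing c_k, a condition that does not depend on the representative y.
   On the k-th stratum the representative with c_k > 0 varies continuously, and it is never
   antipodal to x because <x,y> >= 0 for it, so the shortest arc from x to that representative is an
   effectual instruction. This gives m + 1 domains. The coordinates y_0, ..., y_n serve as c_1, ..., c_(n+1)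
   on any sphere. If n is 1, 3 or 7, then the n imaginary coordinates of the product of the
   conjugate of x with y, in the complex numbers, quaternions or octonions, suffice: the norm is
   multiplicative and the real coordinate of that product is <x,y>. *)
theory Submission
  imports Defs
begin

subsection \<open>Currying for the compact-open topology\<close>

text \<open>Turns joint continuity in point and time into continuity of a map to a path space.
  Subbasic sets suffice: when \<open>h\<close> sends \<open>{x} \<times> K\<close> into
  \<open>U\<close>, the tube lemma and compactness of \<open>K\<close> give a neighbourhood of
  \<open>x\<close> for which this stays true.\<close>

lemma continuous_map_curry_compact_open:
  assumes h: "continuous_map (prod_topology X Y) Z h"
  shows "continuous_map X (compact_open_topology Y Z) (\<lambda>x. restrict (\<lambda>y. h (x, y)) (topspace Y))"
    (is "continuous_map X _ ?g")
proof -
  have cont: "continuous_map Y Z (?g x)" if "x \<in> topspace X" for x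
  proof -
    have "continuous_map Y (prod_topology X Y) (\<lambda>y. (x, y))"
      using that by (simp add: continuous_map_pairwise o_def)
    from continuous_map_compose[OF this h] have "continuous_map Y Z (\<lambda>y. h (x, y))"
      by (simp add: o_def)
    then show ?thesis
      by (rule continuous_map_eq) simp
  qed
  have "openin X (?g -` {f \<in> extensional (topspace Y). continuous_map Y Z f \<and> f ` K \<subseteq> U} \<inter> topspace X)"
    (is "openin X ?V") if K: "compactin Y K" and U: "openin Z U" for K U
  proof (subst openin_subopen, intro ballI)
    fix x assume "x \<in> ?V"
    then have x: "x \<in> topspace X" and sub: "?g x ` K \<subseteq> U" by auto
    have KY: "K \<subseteq> topspace Y" using K by (rule compactin_subset_topspace)
    let ?W = "{p \<in> topspace (prod_topology X Y). h p \<in> U}"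
    have W: "openin (prod_topology X Y) ?W"
      using h U by (rule openin_continuous_map_preimage)
    have "{x} \<times> K \<subseteq> ?W" using x sub KY by auto
    from tube_lemma_right[OF W K x this] obtain A B
      where A: "openin X A" "x \<in> A" and B: "K \<subseteq> B" and AB: "A \<times> B \<subseteq> ?W" by blast
    have "A \<subseteq> ?V"
    proof
      fix a assume a: "a \<in> A"
      then have aX: "a \<in> topspace X" using openin_subset[OF A(1)] by blast
      have "?g a ` K \<subseteq> U" using a B AB KY by auto
      then show "a \<in> ?V" using aX cont[OF aX] by auto
    qed
    with A show "\<exists>T. openin X T \<and> x \<in> T \<and> T \<subseteq> ?V" by blast
  qed
  moreover have "?g ` topspace X \<subseteq> topspace (compact_open_topology Y Z)"
    unfolding topspace_compact_open_topology using cont by auto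
  ultimately show ?thesis
    unfolding compact_open_topology_def topology_generated_by_topspace
    by (intro continuous_on_generated_topo) auto
qed

subsection \<open>Spheres and the antipodal quotient\<close>

definition dot_upto :: "nat \<Rightarrow> (nat \<Rightarrow> real) \<Rightarrow> (nat \<Rightarrow> real) \<Rightarrow> real" where
  "dot_upto n x y = (\<Sum>i\<le>n. x i * y i)"

lemma topspace_nsphere_iff:
  "x \<in> topspace (nsphere n) \<longleftrightarrow> dot_upto n x x = 1 \<and> (\<forall>i>n. x i = 0)"
  by (simp add: nsphere dot_upto_def power2_eq_square)

lemma dot_upto_antipode_right: "dot_upto n x (antipode y) = - dot_upto n x y"
  by (simp add: dot_upto_def antipode_def sum_negf)

lemma antipode_antipode [simp]: "antipode (antipode x) = x"
  by (simp add: antipode_def)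

lemma antipode_in_nsphere [simp]:
  "antipode x \<in> topspace (nsphere n) \<longleftrightarrow> x \<in> topspace (nsphere n)"
  by (simp add: topspace_nsphere_iff dot_upto_def antipode_def)

lemma continuous_map_into_nsphere:
  assumes "\<And>i. continuous_map X euclideanreal (\<lambda>p. f p i)"
    and "\<And>p. p \<in> topspace X \<Longrightarrow> f p \<in> topspace (nsphere n)"
  shows "continuous_map X (nsphere n) f"
  using assms by (auto simp: nsphere continuous_map_in_subtopology continuous_map_componentwise_UNIV)

lemma continuous_map_antipode: "continuous_map (nsphere n) (nsphere n) antipode"
proof (rule continuous_map_into_nsphere)
  show "continuous_map (nsphere n) euclideanreal (\<lambda>x. antipode x i)" for i
    unfolding antipode_def by (intro continuous_map_minus continuous_map_nsphere_projection)
qed simp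

lemma continuous_map_fst_coordinate:
  "continuous_map (prod_topology (nsphere m) Y) euclideanreal (\<lambda>p. fst p i)"
  using continuous_map_compose[OF continuous_map_fst continuous_map_nsphere_projection]
  by (simp add: o_def)

lemma continuous_map_snd_coordinate:
  "continuous_map (prod_topology X (nsphere m)) euclideanreal (\<lambda>p. snd p i)"
  using continuous_map_compose[OF continuous_map_snd continuous_map_nsphere_projection]
  by (simp add: o_def)

section \<open>The antipodal quotient and its product with the sphere\<close>

lemma antipodal_orbit_eq_iff:
  "antipodal_orbit x = antipodal_orbit y \<longleftrightarrow> x = y \<or> x = antipode y"
  unfolding antipodal_orbit_def by (metis antipode_antipode doubleton_eq_iff)

lemma topspace_projective_space:
  "topspace (projective_space n) = antipodal_orbit ` topspace (nsphere n)"
  by (simp add: projective_space_def topspace_quotient_topology)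

lemma continuous_map_antipodal_orbit:
  "continuous_map (nsphere n) (projective_space n) antipodal_orbit"
  unfolding projective_space_def
  by (rule quotient_imp_continuous_map[OF quotient_map_quotient_topology])

text \<open>The saturation of an open \<open>U\<close> is the union of \<open>U\<close> and its
  preimage under the antipodal map, both open.\<close>

lemma open_map_antipodal_orbit: "open_map (nsphere n) (projective_space n) antipodal_orbit"
  unfolding open_map_def
proof (intro allI impI)
  fix U assume U: "openin (nsphere n) U"
  then have sub: "U \<subseteq> topspace (nsphere n)" by (rule openin_subset)
  have "{x \<in> topspace (nsphere n). antipodal_orbit x \<in> antipodal_orbit ` U} =
      U \<union> {x \<in> topspace (nsphere n). antipode x \<in> U}"
    using sub by (auto simp: image_iff antipodal_orbit_eq_iff) (metis antipode_antipode)
  moreover have "openin (nsphere n) (U \<union> {x \<in> topspace (nsphere n). antipode x \<in> U})"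
    using U openin_continuous_map_preimage[OF continuous_map_antipode U] by (rule openin_Un)
  ultimately show "openin (projective_space n) (antipodal_orbit ` U)"
    using sub by (auto simp: projective_space_def openin_quotient_topology)
qed

text \<open>A product of a quotient map with an identity need not be a quotient map in general, but
  openness always passes to such products; hence the detour through open maps.\<close>

lemma open_map_map_prod_id:
  assumes "open_map Y Z f"
  shows "open_map (prod_topology X Y) (prod_topology X Z) (map_prod id f)"
  unfolding open_map_def
proof (intro allI impI)
  fix W assume W: "openin (prod_topology X Y) W"
  show "openin (prod_topology X Z) (map_prod id f ` W)"
    unfolding openin_prod_topology_alt
  proof (intro allI impI)
    fix x z assume "(x, z) \<in> map_prod id f ` W"
    then obtain y where y: "(x, y) \<in> W" "z = f y" by auto
    then obtain U V where UV: "openin X U" "openin Y V" "x \<in> U" "y \<in> V" "U \<times> V \<subseteq> W"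
      using W[unfolded openin_prod_topology_alt, rule_format, OF y(1)] by blast
    have "openin Z (f ` V)" using assms UV(2) by (simp add: open_map_def)
    moreover have "U \<times> f ` V \<subseteq> map_prod id f ` W" using UV(5) by force
    ultimately show "\<exists>U V. openin X U \<and> openin Z V \<and> x \<in> U \<and> z \<in> V \<and> U \<times> V \<subseteq> map_prod id f ` W"
      using UV y by blast
  qed
qed

abbreviation sphere_pairs :: "nat \<Rightarrow> ((nat \<Rightarrow> real) \<times> (nat \<Rightarrow> real)) topology" where
  "sphere_pairs n \<equiv> prod_topology (nsphere n) (nsphere n)"

abbreviation effectual_pairs :: "nat \<Rightarrow> ((nat \<Rightarrow> real) \<times> (nat \<Rightarrow> real) set) topology" where
  "effectual_pairs n \<equiv> prod_topology (nsphere n) (projective_space n)"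

abbreviation orbit_pair ::
    "(nat \<Rightarrow> real) \<times> (nat \<Rightarrow> real) \<Rightarrow> (nat \<Rightarrow> real) \<times> (nat \<Rightarrow> real) set" where
  "orbit_pair \<equiv> map_prod id antipodal_orbit"

lemma orbit_pair_image: "orbit_pair ` topspace (sphere_pairs n) = topspace (effectual_pairs n)"
  by (force simp: topspace_projective_space)

lemma continuous_map_orbit_pair:
  "continuous_map (sphere_pairs n) (effectual_pairs n) orbit_pair"
  unfolding map_prod_def case_prod_beta id_apply
  by (intro continuous_map_pairedI continuous_map_fst
      continuous_map_compose[OF continuous_map_snd continuous_map_antipodal_orbit, unfolded o_def])

text \<open>A saturated set is the full preimage of its image, and an open map restricts to an open
  map over any subset of its target. Continuity on a domain in the quotient can thus be checked on
  pairs of sphere points.\<close>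

lemma quotient_map_orbit_pair_restrict:
  assumes E: "E \<subseteq> topspace (sphere_pairs n)"
    and saturated: "\<And>x y. (x, y) \<in> E \<Longrightarrow> (x, antipode y) \<in> E"
  shows "quotient_map (subtopology (sphere_pairs n) E)
           (subtopology (effectual_pairs n) (orbit_pair ` E)) orbit_pair"
proof (rule continuous_open_imp_quotient_map)
  have "{p \<in> topspace (sphere_pairs n). orbit_pair p \<in> orbit_pair ` E} = E"
    using E saturated by (auto simp: antipodal_orbit_eq_iff)
  then show "open_map (subtopology (sphere_pairs n) E)
      (subtopology (effectual_pairs n) (orbit_pair ` E)) orbit_pair"
    by (intro open_map_restriction open_map_map_prod_id open_map_antipodal_orbit)
  show "continuous_map (subtopology (sphere_pairs n) E)
      (subtopology (effectual_pairs n) (orbit_pair ` E)) orbit_pair"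
    using E by (intro continuous_map_into_subtopology continuous_map_from_subtopology
        continuous_map_orbit_pair) auto
  show "orbit_pair ` topspace (subtopology (sphere_pairs n) E) =
      topspace (subtopology (effectual_pairs n) (orbit_pair ` E))"
    using E orbit_pair_image[of n] by (auto simp del: topspace_prod_topology)
qed

subsection \<open>Shortest arcs\<close>

definition normalized :: "nat \<Rightarrow> (nat \<Rightarrow> real) \<Rightarrow> (nat \<Rightarrow> real)" where
  "normalized n v = (\<lambda>i. v i / sqrt (dot_upto n v v))"

text \<open>The chord is projected radially onto the sphere. This traces the great-circle arc, in
  general not at constant speed, and avoids angles, so that continuity can be checked
  coordinatewise.\<close>

definition shortest_arc :: "nat \<Rightarrow> (nat \<Rightarrow> real) \<Rightarrow> (nat \<Rightarrow> real) \<Rightarrow> real \<Rightarrow> (nat \<Rightarrow> real)" where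
  "shortest_arc n x y t = normalized n (\<lambda>i. (1 - t) * x i + t * y i)"

lemma normalized_in_nsphere:
  assumes "dot_upto n v v > 0" and "\<And>i. i > n \<Longrightarrow> v i = 0"
  shows "normalized n v \<in> topspace (nsphere n)"
proof -
  have "dot_upto n (normalized n v) (normalized n v) = dot_upto n v v / (sqrt (dot_upto n v v))\<^sup>2"
    by (simp add: dot_upto_def normalized_def power2_eq_square flip: sum_divide_distrib)
  then show ?thesis
    using assms by (simp add: topspace_nsphere_iff normalized_def)
qed

lemma normalized_nsphere: "x \<in> topspace (nsphere n) \<Longrightarrow> normalized n x = x"
  by (simp add: normalized_def topspace_nsphere_iff)

text \<open>In the expanded squared norm, \<open>(1 - t)\<^sup>2 + t\<^sup>2\<close> is positive and
  the cross term is nonnegative, so the chord misses the origin.\<close>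

lemma dot_upto_segment_pos:
  assumes x: "x \<in> topspace (nsphere n)" and y: "y \<in> topspace (nsphere n)"
    and xy: "dot_upto n x y \<ge> 0" and t: "t \<in> {0..1}"
  defines "v \<equiv> \<lambda>i. (1 - t) * x i + t * y i"
  shows "dot_upto n v v > 0"
proof -
  have "dot_upto n v v =
      (1 - t)\<^sup>2 * dot_upto n x x + t\<^sup>2 * dot_upto n y y + 2 * (t * (1 - t)) * dot_upto n x y"
    unfolding dot_upto_def v_def sum_distrib_left sum.distrib[symmetric]
    by (rule sum.cong) (auto simp: algebra_simps power2_eq_square)
  also have "\<dots> = (1 - t)\<^sup>2 + t\<^sup>2 + 2 * (t * (1 - t)) * dot_upto n x y"
    using x y by (simp add: topspace_nsphere_iff)
  also have "\<dots> > 0"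
  proof (rule add_pos_nonneg)
    show "(1 - t)\<^sup>2 + t\<^sup>2 > 0" by (simp add: sum_power2_gt_zero_iff)
    show "2 * (t * (1 - t)) * dot_upto n x y \<ge> 0" using t xy by simp
  qed
  finally show ?thesis .
qed

lemma shortest_arc_in_nsphere:
  assumes "x \<in> topspace (nsphere n)" "y \<in> topspace (nsphere n)" "dot_upto n x y \<ge> 0" "t \<in> {0..1}"
  shows "shortest_arc n x y t \<in> topspace (nsphere n)"
  unfolding shortest_arc_def
  using assms by (intro normalized_in_nsphere dot_upto_segment_pos) (auto simp: topspace_nsphere_iff)

lemma shortest_arc_0: "x \<in> topspace (nsphere n) \<Longrightarrow> shortest_arc n x y 0 = x"
  by (simp add: shortest_arc_def normalized_nsphere)

lemma shortest_arc_1: "y \<in> topspace (nsphere n) \<Longrightarrow> shortest_arc n x y 1 = y"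
  by (simp add: shortest_arc_def normalized_nsphere)

lemma continuous_map_shortest_arc:
  assumes f: "continuous_map X (nsphere n) f" and g: "continuous_map X (nsphere n) g"
    and fg: "\<And>p. p \<in> topspace X \<Longrightarrow> dot_upto n (f p) (g p) \<ge> 0"
  shows "continuous_map X (free_path_space (nsphere n))
           (\<lambda>p. restrict (shortest_arc n (f p) (g p)) {0..1})"
proof -
  let ?I = "top_of_set {0..1::real}"
  let ?v = "\<lambda>q i. (1 - snd q) * f (fst q) i + snd q * g (fst q) i"
  have coord: "continuous_map (prod_topology X ?I) euclideanreal (\<lambda>q. h (fst q) i)"
    if "continuous_map X (nsphere n) h" for h and i :: nat
    using continuous_map_compose[OF continuous_map_compose[OF continuous_map_fst that]
        continuous_map_nsphere_projection]
    by (simp add: o_def)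
  have time: "continuous_map (prod_topology X ?I) euclideanreal snd"
    using continuous_map_snd by (rule continuous_map_into_fulltopology)
  have v: "continuous_map (prod_topology X ?I) euclideanreal (\<lambda>q. ?v q i)" for i
    by (intro continuous_intros time coord f g) simp_all
  have pos: "dot_upto n (?v q) (?v q) > 0" if "q \<in> topspace (prod_topology X ?I)" for q
    using that continuous_map_funspace[OF f] continuous_map_funspace[OF g] fg
    by (intro dot_upto_segment_pos) auto
  have "continuous_map (prod_topology X ?I) (nsphere n)
      (\<lambda>q. shortest_arc n (f (fst q)) (g (fst q)) (snd q))"
  proof (rule continuous_map_into_nsphere)
    fix i
    have "continuous_map (prod_topology X ?I) euclideanreal
        (\<lambda>q. ?v q i / sqrt (\<Sum>j\<le>n. ?v q j * ?v q j))"
      using pos by (intro continuous_map_real_divide continuous_map_sqrt continuous_map_sum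
          continuous_map_real_mult v) (auto simp: dot_upto_def order_less_le)
    then show "continuous_map (prod_topology X ?I) euclideanreal
        (\<lambda>q. shortest_arc n (f (fst q)) (g (fst q)) (snd q) i)"
      by (simp add: shortest_arc_def normalized_def dot_upto_def)
  next
    fix q assume "q \<in> topspace (prod_topology X ?I)"
    then show "shortest_arc n (f (fst q)) (g (fst q)) (snd q) \<in> topspace (nsphere n)"
      using continuous_map_funspace[OF f] continuous_map_funspace[OF g] fg
      by (intro shortest_arc_in_nsphere) auto
  qed
  from continuous_map_curry_compact_open[OF this] show ?thesis
    by (simp add: free_path_space_def)
qed

subsection \<open>The planner of a stratification by odd functions\<close>

text \<open>The last assumption makes every stratum nonempty: a partition has no empty block, and
  the number of blocks has to be exactly \<open>m + 1\<close>.\<close>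

locale odd_stratification =
  fixes n m :: nat and c :: "nat \<Rightarrow> (nat \<Rightarrow> real) \<Rightarrow> (nat \<Rightarrow> real) \<Rightarrow> real"
  assumes c_0: "c 0 x y = dot_upto n x y"
    and c_odd: "k \<le> m \<Longrightarrow> c k x (antipode y) = - c k x y"
    and c_cont: "k \<le> m \<Longrightarrow> continuous_map (sphere_pairs n) euclideanreal (\<lambda>p. c k (fst p) (snd p))"
    and c_cover: "x \<in> topspace (nsphere n) \<Longrightarrow> y \<in> topspace (nsphere n) \<Longrightarrow> \<exists>k\<le>m. c k x y \<noteq> 0"
    and c_witness: "k \<le> m \<Longrightarrow> \<exists>x\<in>topspace (nsphere n). \<exists>y\<in>topspace (nsphere n).
          c k x y \<noteq> 0 \<and> (\<forall>j<k. c j x y = 0)"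
begin

definition stratum :: "nat \<Rightarrow> ((nat \<Rightarrow> real) \<times> (nat \<Rightarrow> real)) set" where
  "stratum k = {(x, y). x \<in> topspace (nsphere n) \<and> y \<in> topspace (nsphere n) \<and>
     c k x y \<noteq> 0 \<and> (\<forall>j<k. c j x y = 0)}"

text \<open>Multiplying by the sign, instead of choosing by cases, gives a formula that is visibly
  continuous where \<open>c k\<close> does not vanish.\<close>

definition positive_rep :: "nat \<Rightarrow> (nat \<Rightarrow> real) \<Rightarrow> (nat \<Rightarrow> real) \<Rightarrow> (nat \<Rightarrow> real)" where
  "positive_rep k x y = (\<lambda>i. sgn (c k x y) * y i)"

text \<open>The arbitrary choice of a representative is harmless, since for \<open>k \<le> m\<close>
  both points of an orbit have the same \<open>positive_rep\<close>.\<close>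

definition instruction :: "nat \<Rightarrow> (nat \<Rightarrow> real) \<times> (nat \<Rightarrow> real) set \<Rightarrow> real \<Rightarrow> (nat \<Rightarrow> real)" where
  "instruction k p =
     restrict (shortest_arc n (fst p) (positive_rep k (fst p) (SOME y. y \<in> snd p))) {0..1}"

lemma stratum_subset: "stratum k \<subseteq> topspace (sphere_pairs n)"
  by (auto simp: stratum_def)

lemma stratum_antipode:
  assumes "k \<le> m" "(x, y) \<in> stratum k"
  shows "(x, antipode y) \<in> stratum k"
  using assms by (auto simp: stratum_def c_odd)

lemma stratum_disjoint: "p \<in> stratum j \<Longrightarrow> p \<in> stratum k \<Longrightarrow> j = k"
  unfolding stratum_def by (cases j k rule: linorder_cases) auto

lemma stratum_cover:
  assumes "x \<in> topspace (nsphere n)" "y \<in> topspace (nsphere n)"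
  shows "\<exists>k\<le>m. (x, y) \<in> stratum k"
proof -
  obtain l where l: "l \<le> m" "c l x y \<noteq> 0" using c_cover assms by blast
  define k where "k = (LEAST k. c k x y \<noteq> 0)"
  have "c k x y \<noteq> 0" unfolding k_def using l(2) by (rule LeastI)
  moreover have "\<forall>j<k. c j x y = 0" unfolding k_def using not_less_Least by blast
  moreover have "k \<le> l" unfolding k_def using l(2) by (rule Least_le)
  ultimately show ?thesis using l assms by (intro exI[of _ k]) (simp add: stratum_def)
qed

lemma stratum_nonempty: "k \<le> m \<Longrightarrow> stratum k \<noteq> {}"
  using c_witness[of k] by (auto simp: stratum_def)

text \<open>Strata are disjoint and invariant under the antipodal map in the second factor, so their
  images in the quotient stay disjoint.\<close>

lemma orbit_pair_stratum_eq:
  assumes "k \<le> m" "p \<in> stratum j" "q \<in> stratum k" "orbit_pair p = orbit_pair q"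
  shows "j = k"
  using assms stratum_antipode[of k "fst q" "snd q"]
  by (cases p; cases q) (auto simp: antipodal_orbit_eq_iff dest: stratum_disjoint)

lemma positive_rep_antipode:
  "k \<le> m \<Longrightarrow> positive_rep k x (antipode y) = positive_rep k x y"
  by (simp add: positive_rep_def c_odd sgn_minus) (simp add: antipode_def)

lemma positive_rep_cases:
  assumes "(x, y) \<in> stratum k"
  shows "positive_rep k x y = y \<and> c k x y > 0 \<or> positive_rep k x y = antipode y \<and> c k x y < 0"
  using assms by (auto simp: stratum_def positive_rep_def antipode_def sgn_real_def)

lemma positive_rep_in_nsphere:
  "(x, y) \<in> stratum k \<Longrightarrow> positive_rep k x y \<in> topspace (nsphere n)"
  using positive_rep_cases[of x y k] by (auto simp: stratum_def)

text \<open>On stratum 0 the inner product is itself the function made positive; on every later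
  stratum it vanishes.\<close>

lemma dot_positive_rep:
  assumes "(x, y) \<in> stratum k"
  shows "dot_upto n x (positive_rep k x y) \<ge> 0"
proof (cases "k = 0")
  case True
  then show ?thesis
    using positive_rep_cases[OF assms] by (auto simp: dot_upto_antipode_right c_0)
next
  case False
  then have "dot_upto n x y = 0" using assms by (auto simp: stratum_def simp flip: c_0)
  then show ?thesis
    using positive_rep_cases[OF assms] by (auto simp: dot_upto_antipode_right)
qed

lemma instruction_orbit_pair:
  assumes "k \<le> m"
  shows "instruction k (orbit_pair (x, y)) = restrict (shortest_arc n x (positive_rep k x y)) {0..1}"
proof -
  have "(SOME z. z \<in> antipodal_orbit y) \<in> antipodal_orbit y"
    by (rule someI[of _ y]) (simp add: antipodal_orbit_def)
  then have "(SOME z. z \<in> antipodal_orbit y) = y \<or> (SOME z. z \<in> antipodal_orbit y) = antipode y"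
    by (simp add: antipodal_orbit_def)
  then show ?thesis
    using assms by (auto simp: instruction_def positive_rep_antipode)
qed

text \<open>The arc depends continuously on a pair of sphere points in the stratum, and the
  resulting map factors through the restricted quotient map.\<close>

lemma continuous_map_instruction:
  assumes k: "k \<le> m"
  shows "continuous_map (subtopology (effectual_pairs n) (orbit_pair ` stratum k))
           (free_path_space (nsphere n)) (instruction k)"
proof -
  let ?X = "subtopology (sphere_pairs n) (stratum k)"
  have X: "p \<in> topspace ?X \<longleftrightarrow> p \<in> stratum k" for p
    using stratum_subset[of k] by auto
  have sign: "continuous_map ?X euclideanreal (\<lambda>p. sgn (c k (fst p) (snd p)))"
    \<comment> \<open>The sign becomes \<open>c / \<bar>c\<bar>\<close>, whose denominator is
      nonzero on the stratum.\<close>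
    unfolding real_sgn_eq
    using k X by (intro continuous_map_real_divide continuous_map_real_abs
        continuous_map_from_subtopology c_cont) (auto simp: stratum_def)
  have rep: "continuous_map ?X (nsphere n) (\<lambda>p. positive_rep k (fst p) (snd p))"
  proof (rule continuous_map_into_nsphere)
    show "continuous_map ?X euclideanreal (\<lambda>p. positive_rep k (fst p) (snd p) i)" for i
      unfolding positive_rep_def
      by (intro continuous_map_real_mult sign continuous_map_from_subtopology
          continuous_map_snd_coordinate)
  qed (use X positive_rep_in_nsphere in \<open>simp only: prod.collapse\<close>)
  have "continuous_map ?X (free_path_space (nsphere n))
      (\<lambda>p. restrict (shortest_arc n (fst p) (positive_rep k (fst p) (snd p))) {0..1})"
  proof (rule continuous_map_shortest_arc[OF _ rep])
    show "continuous_map ?X (nsphere n) fst"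
      by (intro continuous_map_from_subtopology continuous_map_fst)
  qed (use X dot_positive_rep in \<open>simp only: prod.collapse\<close>)
  moreover have "(\<lambda>p. restrict (shortest_arc n (fst p) (positive_rep k (fst p) (snd p))) {0..1}) =
      instruction k \<circ> orbit_pair"
    using instruction_orbit_pair[OF k] by (auto simp: fun_eq_iff)
  ultimately show ?thesis
    using quotient_map_orbit_pair_restrict[OF stratum_subset stratum_antipode[OF k]]
    by (auto intro: continuous_compose_quotient_map)
qed

lemma effectual_endpoints_instruction:
  assumes k: "k \<le> m" and p: "p \<in> orbit_pair ` stratum k"
  shows "effectual_endpoints (instruction k p) = p"
proof -
  obtain x y where xy: "(x, y) \<in> stratum k" and p: "p = orbit_pair (x, y)" using p by auto
  have "antipodal_orbit (positive_rep k x y) = antipodal_orbit y"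
    using positive_rep_cases[OF xy] by (auto simp: antipodal_orbit_eq_iff)
  moreover have "x \<in> topspace (nsphere n)" using xy by (simp add: stratum_def)
  ultimately show ?thesis
    unfolding p instruction_orbit_pair[OF k] effectual_endpoints_def
    using positive_rep_in_nsphere[OF xy] by (simp add: shortest_arc_0 shortest_arc_1)
qed

theorem exists_effectual_motion_planner:
  "\<exists>P s. effectual_motion_planner n P s \<and> card P = m + 1"
proof -
  let ?D = "\<lambda>k. orbit_pair ` stratum k"
  have disj: "j = k" if "k \<le> m" "p \<in> ?D j" "p \<in> ?D k" for j k p
    using that by (elim imageE) (metis orbit_pair_stratum_eq)
  \<comment> \<open>Nonempty disjoint domains are distinct, which gives the exact count and lets a
    domain determine its index.\<close>
  have inj: "inj_on ?D {..m}"
  proof (rule inj_onI)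
    fix j k assume jk: "j \<in> {..m}" "k \<in> {..m}" "?D j = ?D k"
    obtain p where "p \<in> ?D j" using stratum_nonempty[of j] jk(1) by blast
    then show "j = k" using jk disj[of k p j] by simp
  qed
  have "partition_on (topspace (effectual_pairs n)) (?D ` {..m})"
  proof (rule partition_onI)
    show "\<Union> (?D ` {..m}) = topspace (effectual_pairs n)"
    proof
      show "\<Union> (?D ` {..m}) \<subseteq> topspace (effectual_pairs n)"
        unfolding orbit_pair_image[symmetric] using stratum_subset by blast
      show "topspace (effectual_pairs n) \<subseteq> \<Union> (?D ` {..m})"
        unfolding orbit_pair_image[symmetric]
      proof (rule image_subsetI)
        fix q assume "q \<in> topspace (sphere_pairs n)"
        then obtain k where "k \<le> m" "q \<in> stratum k"
          using stratum_cover[of "fst q" "snd q"] by auto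
        then show "orbit_pair q \<in> \<Union> (?D ` {..m})" by blast
      qed
    qed
    show "disjnt A B" if AB: "A \<in> ?D ` {..m}" "B \<in> ?D ` {..m}" "A \<noteq> B" for A B
    proof -
      obtain j k where jk: "k \<le> m" "A = ?D j" "B = ?D k" using AB by auto
      show ?thesis
        unfolding disjnt_iff
      proof (intro allI notI, elim conjE)
        fix p assume "p \<in> A" "p \<in> B"
        then have "j = k" using disj jk by simp
        with jk \<open>A \<noteq> B\<close> show False by simp
      qed
    qed
    show "{} \<notin> ?D ` {..m}" using stratum_nonempty by auto
  qed
  moreover have "card (?D ` {..m}) = m + 1"
    using inj by (simp add: card_image)
  moreover have "inv_into {..m} ?D (?D k) = k" if "k \<le> m" for k
    using that by (intro inv_into_f_f[OF inj]) simp
  \<comment> \<open>A planner takes the domain itself as index, so \<open>inv_into\<close> recovers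
    the number of the stratum.\<close>
  ultimately have "effectual_motion_planner n (?D ` {..m}) (\<lambda>D. instruction (inv_into {..m} ?D D))"
    unfolding effectual_motion_planner_def
    using continuous_map_instruction effectual_endpoints_instruction
    by simp
  with \<open>card _ = _\<close> show ?thesis by blast
qed

end

subsection \<open>The two stratifications\<close>

definition unit_sequence :: "nat \<Rightarrow> nat \<Rightarrow> real" where
  "unit_sequence k = (\<lambda>i. if i = k then 1 else 0)"

lemma unit_sequence_in_nsphere: "k \<le> n \<Longrightarrow> unit_sequence k \<in> topspace (nsphere n)"
  by (auto simp: topspace_nsphere_iff dot_upto_def unit_sequence_def if_distrib cong: if_cong)

lemma dot_unit_sequence:
  "dot_upto n (unit_sequence j) (unit_sequence k) = (if j = k \<and> k \<le> n then 1 else 0)"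
proof -
  have "unit_sequence j i * unit_sequence k i = (if i = k then if j = k then 1 else 0 else 0)" for i
    by (simp add: unit_sequence_def)
  then show ?thesis by (simp add: dot_upto_def)
qed

lemma continuous_map_dot_upto:
  "continuous_map (sphere_pairs n) euclideanreal (\<lambda>p. dot_upto n (fst p) (snd p))"
  unfolding dot_upto_def
  by (intro continuous_map_sum continuous_map_real_mult continuous_map_fst_coordinate
      continuous_map_snd_coordinate) simp

text \<open>A point of the sphere has a nonzero coordinate, so there is no common zero. Index 0 is
  taken by the inner product, hence coordinate \<open>i\<close> sits at index
  \<open>i + 1\<close>.\<close>

lemma odd_stratification_coordinates:
  assumes "n \<ge> 1"
  shows "odd_stratification n (n + 1)
           (\<lambda>k x y. if k = 0 then dot_upto n x y else y (k - 1))"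
proof
  fix k x y
  show "(if (0::nat) = 0 then dot_upto n x y else y (0 - 1)) = dot_upto n x y" by simp
  show "(if k = 0 then dot_upto n x (antipode y) else antipode y (k - 1)) =
      - (if k = 0 then dot_upto n x y else y (k - 1))"
    by (simp add: dot_upto_antipode_right) (simp add: antipode_def)
  show "continuous_map (sphere_pairs n) euclideanreal
      (\<lambda>p. if k = 0 then dot_upto n (fst p) (snd p) else snd p (k - 1))"
    by (cases "k = 0") (simp_all add: continuous_map_dot_upto continuous_map_snd_coordinate)
next
  fix x y :: "nat \<Rightarrow> real" assume "y \<in> topspace (nsphere n)"
  then have "(\<Sum>i\<le>n. y i * y i) \<noteq> 0" by (simp add: topspace_nsphere_iff dot_upto_def)
  then obtain i where "i \<le> n" "y i \<noteq> 0"
    by (metis (no_types, lifting) atMost_iff mult_eq_0_iff sum.not_neutral_contains_not_neutral)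
  then show "\<exists>k\<le>n + 1. (if k = 0 then dot_upto n x y else y (k - 1)) \<noteq> 0"
    by (intro exI[of _ "Suc i"]) simp
next
  fix k assume k: "k \<le> n + 1"
  \<comment> \<open>The witness is \<open>x = e_i\<close>, \<open>y = e_j\<close>. For
    \<open>k = 0\<close> both are \<open>e_0\<close>. For \<open>k > 0\<close> the first nonzero
    coordinate of \<open>y = e_(k-1)\<close> is the required one, and \<open>x\<close> must be
    orthogonal to \<open>y\<close>: \<open>e_0\<close> serves unless \<open>k = 1\<close>, where
    \<open>e_1\<close> is taken, available because \<open>n \<ge> 1\<close>.\<close>
  define j :: nat where "j = (if k = 0 then 0 else k - 1)"
  define i :: nat where "i = (if k = 0 then 0 else if k = 1 then 1 else 0)"
  have "i \<le> n" "j \<le> n" using k assms by (auto simp: i_def j_def)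
  moreover have "(if k = 0 then dot_upto n (unit_sequence i) (unit_sequence j)
        else unit_sequence j (k - 1)) \<noteq> 0"
    by (simp add: dot_unit_sequence i_def j_def) (simp add: unit_sequence_def)
  moreover have "(if l = 0 then dot_upto n (unit_sequence i) (unit_sequence j)
        else unit_sequence j (l - 1)) = 0" if "l < k" for l
    using that by (simp add: dot_unit_sequence i_def j_def) (auto simp: unit_sequence_def)
  ultimately show "\<exists>x\<in>topspace (nsphere n). \<exists>y\<in>topspace (nsphere n).
      (if k = 0 then dot_upto n x y else y (k - 1)) \<noteq> 0 \<and>
      (\<forall>j<k. (if j = 0 then dot_upto n x y else y (j - 1)) = 0)"
    using unit_sequence_in_nsphere by metis
qed

section \<open>Octonion multiplication, for n = 1, 3, 7\<close>

text \<open>The coordinates of the octonion product of the conjugate of \<open>x\<close> with \<open>y\<close>. In this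
  Cayley-Dickson basis the sequences supported in \<open>{0, 1}\<close> and in \<open>{0, \<dots>, 3}\<close> form the
  subalgebras of complex numbers and quaternions.\<close>

definition conj_mult_coords :: "(nat \<Rightarrow> real) \<Rightarrow> (nat \<Rightarrow> real) \<Rightarrow> real list" where
  "conj_mult_coords x y =
    [x 0 * y 0 + x 1 * y 1 + x 2 * y 2 + x 3 * y 3 + x 4 * y 4 + x 5 * y 5 + x 6 * y 6 + x 7 * y 7,
     x 0 * y 1 - x 1 * y 0 - x 2 * y 3 + x 3 * y 2 - x 4 * y 5 + x 5 * y 4 + x 6 * y 7 - x 7 * y 6,
     x 0 * y 2 + x 1 * y 3 - x 2 * y 0 - x 3 * y 1 - x 4 * y 6 - x 5 * y 7 + x 6 * y 4 + x 7 * y 5,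
     x 0 * y 3 - x 1 * y 2 + x 2 * y 1 - x 3 * y 0 - x 4 * y 7 + x 5 * y 6 - x 6 * y 5 + x 7 * y 4,
     x 0 * y 4 + x 1 * y 5 + x 2 * y 6 + x 3 * y 7 - x 4 * y 0 - x 5 * y 1 - x 6 * y 2 - x 7 * y 3,
     x 0 * y 5 - x 1 * y 4 + x 2 * y 7 - x 3 * y 6 + x 4 * y 1 - x 5 * y 0 + x 6 * y 3 - x 7 * y 2,
     x 0 * y 6 - x 1 * y 7 - x 2 * y 4 + x 3 * y 5 + x 4 * y 2 - x 5 * y 3 - x 6 * y 0 + x 7 * y 1,
     x 0 * y 7 + x 1 * y 6 - x 2 * y 5 - x 3 * y 4 + x 4 * y 3 + x 5 * y 2 - x 6 * y 1 - x 7 * y 0]"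

text \<open>Indices above 7 run off the list and have no determined value, hence the bounds by 7
  below.\<close>

definition conj_mult :: "nat \<Rightarrow> (nat \<Rightarrow> real) \<Rightarrow> (nat \<Rightarrow> real) \<Rightarrow> real" where
  "conj_mult k x y = conj_mult_coords x y ! k"

lemma atMost_7: "{..7::nat} = {0, 1, 2, 3, 4, 5, 6, 7}"
  by auto

lemma le_7_cases:
  "(k::nat) \<le> 7 \<longleftrightarrow> k = 0 \<or> k = 1 \<or> k = 2 \<or> k = 3 \<or> k = 4 \<or> k = 5 \<or> k = 6 \<or> k = 7"
  by auto

lemmas conj_mult_simps = conj_mult_def conj_mult_coords_def

text \<open>Degen's eight-square identity: the octonion norm is multiplicative and invariant under
  conjugation.\<close>

lemma sum_conj_mult_squares:
  "(\<Sum>k\<le>7. (conj_mult k x y)\<^sup>2) = (\<Sum>i\<le>7. (x i)\<^sup>2) * (\<Sum>i\<le>7. (y i)\<^sup>2)"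
  unfolding atMost_7 by (simp add: conj_mult_simps) algebra

lemma conj_mult_antipode: "k \<le> 7 \<Longrightarrow> conj_mult k x (antipode y) = - conj_mult k x y"
  unfolding le_7_cases by (auto simp: conj_mult_simps antipode_def)

lemma continuous_map_conj_mult:
  "k \<le> 7 \<Longrightarrow> continuous_map (sphere_pairs n) euclideanreal (\<lambda>p. conj_mult k (fst p) (snd p))"
  unfolding le_7_cases
  by (elim disjE; simp add: conj_mult_simps;
      intro continuous_map_add continuous_map_diff continuous_map_real_mult
        continuous_map_fst_coordinate continuous_map_snd_coordinate)

text \<open>The sequence \<open>unit_sequence 0\<close> is the unit of the algebra, so the product
  is the basis element \<open>e_k\<close>. This supplies the witnesses for nonempty strata.\<close>

lemma conj_mult_unit_sequence:
  "j \<le> 7 \<Longrightarrow> k \<le> 7 \<Longrightarrow> conj_mult j (unit_sequence 0) (unit_sequence k) = (if j = k then 1 else 0)"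
  unfolding le_7_cases by (elim disjE; simp add: conj_mult_simps unit_sequence_def)

lemma sum_atMost_7_eq:
  fixes f :: "nat \<Rightarrow> real"
  assumes "n \<le> 7" and "\<And>i. i > n \<Longrightarrow> i \<le> 7 \<Longrightarrow> f i = 0"
  shows "(\<Sum>i\<le>7. f i) = (\<Sum>i\<le>n. f i)"
  using assms by (intro sum.mono_neutral_right) auto

text \<open>Complex numbers and quaternions are closed under conjugation and product, so one
  octonion formula serves all three dimensions.\<close>

lemma conj_mult_subalgebra:
  assumes "n \<in> {1, 3, 7}" and "\<forall>i>n. x i = 0" and "\<forall>i>n. y i = 0" and "n < k" "k \<le> 7"
  shows "conj_mult k x y = 0"
  using assms(1) assms(2-5) unfolding le_7_cases by (elim insertE; elim disjE; simp add: conj_mult_simps)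

text \<open>Index 0 is set to \<open>dot_upto n\<close> because the locale demands equality for all
  sequences; for \<open>n < 7\<close>, \<open>conj_mult 0\<close> agrees with it on the sphere but
  not everywhere.\<close>

lemma odd_stratification_conj_mult:
  assumes n: "n \<in> {1, 3, 7}"
  shows "odd_stratification n n (\<lambda>k x y. if k = 0 then dot_upto n x y else conj_mult k x y)"
proof
  have n7: "n \<le> 7" using n by auto
  fix k x y
  show "(if (0::nat) = 0 then dot_upto n x y else conj_mult 0 x y) = dot_upto n x y" by simp
  assume k: "k \<le> n"
  show "(if k = 0 then dot_upto n x (antipode y) else conj_mult k x (antipode y)) =
      - (if k = 0 then dot_upto n x y else conj_mult k x y)"
    using k n7 by (simp add: dot_upto_antipode_right conj_mult_antipode)
  show "continuous_map (sphere_pairs n) euclideanreal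
      (\<lambda>p. if k = 0 then dot_upto n (fst p) (snd p) else conj_mult k (fst p) (snd p))"
    using k n7 by (cases "k = 0") (simp_all add: continuous_map_dot_upto continuous_map_conj_mult)
next
  have n7: "n \<le> 7" using n by auto
  fix x y assume x: "x \<in> topspace (nsphere n)" and y: "y \<in> topspace (nsphere n)"
  have supp: "\<forall>i>n. x i = 0" "\<forall>i>n. y i = 0"
    using x y by (auto simp: topspace_nsphere_iff)
  have unit: "(\<Sum>i\<le>7. (z i)\<^sup>2) = 1" if "z \<in> topspace (nsphere n)" for z
    using that n7 sum_atMost_7_eq[of n "\<lambda>i. (z i)\<^sup>2"]
    by (simp add: topspace_nsphere_iff dot_upto_def power2_eq_square)
  \<comment> \<open>A product of unit octonions has norm 1, so some coordinate is nonzero; closure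
    of the subalgebra then forces its index to be at most \<open>n\<close>.\<close>
  have "(\<Sum>k\<le>7. (conj_mult k x y)\<^sup>2) \<noteq> 0"
    unfolding sum_conj_mult_squares by (simp add: unit x y)
  then obtain k where k: "k \<le> 7" "conj_mult k x y \<noteq> 0"
    by (metis (no_types, lifting) atMost_iff sum.neutral zero_eq_power2)
  with n supp have "k \<le> n" using conj_mult_subalgebra not_le by blast
  moreover have "dot_upto n x y = conj_mult 0 x y"
    using n7 sum_atMost_7_eq[of n "\<lambda>i. x i * y i"] supp
    by (simp add: dot_upto_def atMost_7 conj_mult_simps)
  ultimately show "\<exists>k\<le>n. (if k = 0 then dot_upto n x y else conj_mult k x y) \<noteq> 0"
    using k by (metis (no_types, lifting))
next
  have n7: "n \<le> 7" using n by auto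
  fix k assume k: "k \<le> n"
  have "(if k = 0 then dot_upto n (unit_sequence 0) (unit_sequence k)
      else conj_mult k (unit_sequence 0) (unit_sequence k)) \<noteq> 0"
    using k n7 by (simp add: dot_unit_sequence conj_mult_unit_sequence)
  moreover have "(if j = 0 then dot_upto n (unit_sequence 0) (unit_sequence k)
      else conj_mult j (unit_sequence 0) (unit_sequence k)) = 0" if "j < k" for j
    using that k n7 by (simp add: dot_unit_sequence conj_mult_unit_sequence)
  ultimately show "\<exists>x\<in>topspace (nsphere n). \<exists>y\<in>topspace (nsphere n).
      (if k = 0 then dot_upto n x y else conj_mult k x y) \<noteq> 0 \<and>
      (\<forall>j<k. (if j = 0 then dot_upto n x y else conj_mult j x y) = 0)"
    using k unit_sequence_in_nsphere by (metis le0)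
qed

theorem mainTheorem4:
  fixes n :: nat
  assumes "n \<ge> 1"
  shows "(\<exists>P s. effectual_motion_planner n P s \<and> card P = n + 2) \<and>
         (n \<in> {1, 3, 7} \<longrightarrow> (\<exists>P s. effectual_motion_planner n P s \<and> card P = n + 1))"
  \<comment> \<open>Strata are numbered from 0 to \<open>m\<close>; \<open>m = n + 1\<close> gives
    \<open>n + 2\<close> domains and \<open>m = n\<close> gives \<open>n + 1\<close>.\<close>
  using odd_stratification.exists_effectual_motion_planner[OF odd_stratification_coordinates[OF assms]]
    odd_stratification.exists_effectual_motion_planner[OF odd_stratification_conj_mult]
  by simp

end
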